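(* Let $n\geq 1$, $a=[n,n+1,n+2,n+3,n+4]$, and $b=F_nF_{n+1}F_{n+2}F_{n+3}F_{n+4}$. Then \[ z(b)=\begin{cases} a, & \text{if } n\equiv 1,2,3,4,5,6,7,10 \pmod{12}, \text{ or } n\equiv 8,60\pmod{72};\\ 2a, & \text{if } n\equiv 9,11\pmod{12}, \text{ or } n\equiv 24,44\pmod{72};\\ 3a, & \text{if } n\equiv 12,32,36,56\pmod{72};\\ 6a, & \text{if } n\equiv 0,20,48,68\pmod{72}. \end{cases} \]
   Context: $F_n$ is the $n$th Fibonacci number ($F_1=F_2=1$, $F_n=F_{n-1}+F_{n-2}$). For a positive integer $m$, $z(m)$ is the smallest positive integer $k$ with $m\mid F_k$. $[\cdots]$ denotes lcm. *)

theory Defs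
  imports "HOL-Number_Theory.Number_Theory"
begin

(* A minimum exists for every m > 0; the value at m = 0 is a meaningless LEAST
   over an empty set of candidates. *)
definition fib_order :: "nat \<Rightarrow> nat" where
  "fib_order m = (LEAST k. 0 < k \<and> m dvd fib k)"

end

(* A k with b dvd fib k is a multiple of a, because fib i dvd fib k forces i dvd k for i \<noteq> 2,
   and a window containing 2 also contains 4. Conversely let a dvd k. Since
   gcd (fib i, fib j) = fib (gcd (i, j)), any two factors of b have gcd 1, 2 or 3, so at primes
   other than 2 and 3 the divisibility b dvd fib k holds automatically. Since 12 dvd a, the valuations of
   fib k at 2 and 3 are v2 k + 2 and v3 k + 1. Hence z(b) = 2^e 3^f a, where e and f measure by
   how much v2 b exceeds v2 a + 2 and v3 b exceeds v3 a + 1. These excesses are 0 or 1, and they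
   are determined by n mod 24 and n mod 36, respectively. *)

theory Submission
  imports Defs "HOL-Library.Code_Binary_Nat"
begin

section \<open>Divisibility between Fibonacci numbers\<close>

lemma fib_dvd: "m dvd n \<Longrightarrow> fib m dvd fib n"
  by (metis fib_gcd gcd_nat.absorb_iff1)

text \<open>The assumption gives \<open>fib (gcd m n) = fib m\<close>. On positive indices the only
  repeated value is \<open>fib 1 = fib 2\<close>, so \<open>gcd m n = m\<close> unless
  \<open>m = 2\<close>.\<close>

lemma dvd_of_fib_dvd:
  assumes "fib m dvd fib n" "m \<noteq> 2" "n > 0"
  shows "m dvd n"
proof -
  \<comment> \<open>If \<open>i < j\<close>, then \<open>j \<ge> 3\<close>, and \<open>fib j\<close>
    exceeds \<open>fib (j - 1) \<ge> fib i\<close> by the positive summand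
    \<open>fib (j - 2)\<close>.\<close>
  have strict: "i = j" if "fib i = fib j" "0 < i" "i \<le> j" "j \<noteq> 2" for i j
  proof (rule ccontr)
    assume "i \<noteq> j"
    with that have "i < j" "j \<ge> 3" by auto
    then obtain l where l: "j = Suc (Suc l)" "l > 0"
      by (metis Suc_le_D Suc_le_mono gr0I not_less_eq_eq numeral_3_eq_3 zero_less_Suc)
    have "fib i \<le> fib (Suc l)" using \<open>i < j\<close> l by (intro fib_mono) auto
    with l that fib_neq_0_nat[of l] show False by simp
  qed
  show ?thesis
  proof (cases "m = 0")
    case True
    then show ?thesis using assms fib_neq_0_nat[of n] by auto
  next
    case False
    have "fib (gcd m n) = fib m" using assms(1) by (simp add: fib_gcd gcd_nat.absorb1)
    from strict[OF this] False assms(2) have "gcd m n = m"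
      by (simp add: gcd_le1_nat)
    then show ?thesis by (metis gcd_dvd2)
  qed
qed

section \<open>Fibonacci residues modulo divisors of 144\<close>

text \<open>The addition formula applies with \<open>fib 24\<close> congruent to 0 and
  \<open>fib 23\<close> to 1 modulo 144. The modulus 144 covers the moduli 4, 16 and 9 from which
  valuations are read off below.\<close>

lemma fib_mod_144: "fib (n mod 24) mod 144 = fib n mod 144"
proof (induction n rule: less_induct)
  case (less n)
  show ?case
  proof (cases "n < 24")
    case False
    then obtain k where k: "n = k + 24" by (metis add.commute le_Suc_ex not_less)
    have "fib 24 = 144 * 322" "fib 23 = 144 * 199 + 1" by code_simp+
    moreover have "fib n = fib 24 * fib (Suc k) + fib 23 * fib k"
      using fib_add[of k 23] unfolding k by (simp only: Suc_numeral add_Suc_right[symmetric]) simp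
    ultimately have "fib n = fib k + 144 * (322 * fib (Suc k) + 199 * fib k)"
      by (simp only:) (simp add: algebra_simps)
    then have "fib n mod 144 = fib k mod 144" by (metis mod_mult_self2)
    with less.IH[of k] k show ?thesis by simp
  qed simp
qed

text \<open>Periodicity turns a claim about all indices in given classes modulo \<open>c\<close>
  into a check of 24 values, which evaluation settles.\<close>

lemma fib_mod_table:
  assumes "\<forall>k\<in>set [0..<24]. P (k mod c) \<longrightarrow> Q (fib k mod d)"
    and "c dvd 24" "d dvd 144" "P (n mod c)"
  shows "Q (fib n mod d)"
proof -
  have "fib (n mod 24) mod d = fib n mod d"
    using arg_cong[OF fib_mod_144[of n], of "\<lambda>x. x mod d"]
    unfolding mod_mod_cancel[OF assms(3)] .
  moreover have "n mod 24 mod c = n mod c" using assms(2) by (rule mod_mod_cancel)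
  moreover have "n mod 24 \<in> set [0..<24]" by simp
  ultimately show ?thesis using assms(1,4) by metis
qed

section \<open>Valuations of Fibonacci numbers at 2 and 3\<close>

lemma multiplicity_eq_mod:
  fixes p x :: nat
  assumes "x mod p ^ Suc e = r" "p ^ e dvd r" "r \<noteq> 0"
  shows "multiplicity p x = e"
proof (rule multiplicity_eqI)
  show "p ^ e dvd x" using assms by (metis dvd_mod_iff le_imp_power_dvd le_SucI order_refl)
  show "\<not> p ^ Suc e dvd x" using assms by (auto simp: dvd_eq_mod_eq_0)
qed

text \<open>Since \<open>fib 3 = 2\<close>, divisibility by 2 passes to the indices;
  \<open>fib 4 = 3\<close> serves the same purpose for 3 in the next lemma.\<close>

lemma odd_fib_iff: "odd (fib n) \<longleftrightarrow> \<not> 3 dvd n"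
proof -
  have "fib 3 = 2" by code_simp
  show ?thesis
    using dvd_of_fib_dvd[of 3 n] fib_dvd[of 3 n] \<open>fib 3 = 2\<close> by (cases "n = 0") auto
qed

lemma three_dvd_fib_iff: "3 dvd fib n \<longleftrightarrow> 4 dvd n"
proof -
  have "fib 4 = 3" by code_simp
  show ?thesis
    using dvd_of_fib_dvd[of 4 n] fib_dvd[of 4 n] \<open>fib 4 = 3\<close> by (cases "n = 0") auto
qed

lemma multiplicity_2_fib_odd:
  assumes "n mod 6 = 3"
  shows "multiplicity 2 (fib n) = 1"
proof (rule multiplicity_eq_mod)
  have "\<forall>k\<in>set [0..<24]. k mod 6 = 3 \<longrightarrow> fib k mod 4 = 2" by code_simp
  from fib_mod_table[of "\<lambda>r. r = 3", OF this] assms have "fib n mod 4 = 2" by simp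
  then show "fib n mod 2 ^ Suc 1 = 2" by simp
qed simp_all

text \<open>Induction by halving: \<open>fib (2 * k)\<close> is \<open>fib k\<close> times
  \<open>2 * fib (k - 1) + fib k\<close>, and the second factor has valuation exactly 1. The
  induction starts at the odd multiples of 6, where \<open>fib n\<close> is 8 modulo 16.\<close>

lemma multiplicity_2_fib:
  assumes "6 dvd n" "n > 0"
  shows "multiplicity 2 (fib n) = multiplicity 2 n + 2"
  using assms
proof (induction n rule: less_induct)
  case (less n)
  show ?case
  proof (cases "12 dvd n")
    case True
    then obtain k where n: "n = 2 * k" "6 dvd k" "k > 0" using less.prems by fastforce
    have "fib 6 = 8" by code_simp
    then have "8 dvd fib k" using fib_dvd[OF n(2)] by simp
    \<comment> \<open>As \<open>k\<close> is a positive multiple of 6, \<open>k - 1\<close> is 2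
      modulo 3.\<close>
    moreover have "odd (fib (k - 1))"
      using n unfolding odd_fib_iff by presburger
    ultimately have "(2 * fib (k - 1) + fib k) mod 4 = 2" by presburger
    then have "multiplicity 2 (2 * fib (k - 1) + fib k) = 1"
      by (intro multiplicity_eq_mod[of _ _ _ 2]) simp_all
    moreover have "2 * fib (k - 1) + fib k \<noteq> 0" "fib k \<noteq> 0"
      using fib_neq_0_nat[of k] n by auto
    ultimately have "multiplicity 2 (fib n) = 1 + multiplicity 2 (fib k)"
      unfolding n(1) fib_rec_even'
      by (subst prime_elem_multiplicity_mult_distrib) auto
    also have "multiplicity 2 (fib k) = multiplicity 2 k + 2"
      using less.IH[of k] n by simp
    finally show ?thesis using n by (simp add: multiplicity_times_same)
  next
    case False
    with less.prems have n: "n mod 12 = 6" "n mod 4 = 2" by presburger+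
    have "\<forall>k\<in>set [0..<24]. k mod 12 = 6 \<longrightarrow> fib k mod 16 = 8" by code_simp
    from fib_mod_table[of "\<lambda>r. r = 6", OF this] n have "fib n mod 16 = 8" by simp
    then have "multiplicity 2 (fib n) = 3"
      by (intro multiplicity_eq_mod[of _ _ _ 8]) simp_all
    moreover have "multiplicity 2 n = 1"
      using n by (intro multiplicity_eq_mod[of _ _ _ 2]) simp_all
    ultimately show ?thesis by simp
  qed
qed

text \<open>The addition formula combined with Cassini's identity, whose sign is fixed by the parity
  of \<open>n\<close>. This is the tripling step for valuations at 3.\<close>

lemma fib_triple:
  assumes "even n"
  shows "fib (3 * n) = fib n * (5 * fib n ^ 2 + 3)"
proof (cases n)
  case (Suc m)
  have cassini: "fib m * (fib m + fib n) = fib n ^ 2 + 1"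
    using fib_Cassini_nat[of m] Suc assms by (simp add: algebra_simps)
  have "3 * n = Suc (2 * n + m)" using Suc by simp
  then have "fib (3 * n) = fib (Suc (2 * n + m))" by (rule arg_cong)
  also have "\<dots> = fib n * fib (Suc (2 * n)) + fib m * fib (2 * n)"
    using Suc by (simp only: fib_add)
  also have "fib (Suc (2 * n)) = fib n ^ 2 + (fib m + fib n) ^ 2"
    unfolding fib_rec_odd using Suc by simp
  also have "fib (2 * n) = (2 * fib m + fib n) * fib n"
    unfolding fib_rec_even' using Suc by simp
  finally have "fib (3 * n) = fib n * (3 * (fib m * (fib m + fib n)) + 2 * fib n ^ 2)"
    by (simp add: algebra_simps power2_eq_square)
  then show ?thesis unfolding cassini by simp
qed simp

text \<open>Induction by division by 3: for \<open>n = 3 * k\<close>, 3 divides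
  \<open>fib k\<close>, so the cofactor in \<open>fib_triple\<close> is 3 modulo 9 and contributes
  exactly 1. For \<open>n\<close> not divisible by 3, \<open>fib n\<close> is 3 or 6 modulo
  9.\<close>

lemma multiplicity_3_fib:
  assumes "4 dvd n" "n > 0"
  shows "multiplicity 3 (fib n) = multiplicity 3 n + 1"
  using assms
proof (induction n rule: less_induct)
  case (less n)
  show ?case
  proof (cases "3 dvd n")
    case True
    then obtain k where n: "n = 3 * k" by blast
    with less.prems have k: "4 dvd k" "k > 0" by presburger+
    then obtain c where c: "fib k = 3 * c" using three_dvd_fib_iff by blast
    have "5 * fib k ^ 2 + 3 = 3 * (3 * (5 * c ^ 2) + 1)"
      unfolding c by (simp add: power2_eq_square)
    then have "(5 * fib k ^ 2 + 3) mod 9 = 3" by presburger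
    then have "multiplicity 3 (5 * fib k ^ 2 + 3) = 1"
      by (intro multiplicity_eq_mod[of _ _ _ 3]) simp_all
    moreover have "fib k \<noteq> 0" using fib_neq_0_nat[of k] k by auto
    moreover have "even k" using k by presburger
    ultimately have "multiplicity 3 (fib n) = multiplicity 3 (fib k) + 1"
      unfolding n by (subst fib_triple) (auto simp: prime_elem_multiplicity_mult_distrib)
    also have "multiplicity 3 (fib k) = multiplicity 3 k + 1"
      using less.IH[of k] n k by simp
    finally show ?thesis using n k by (simp add: multiplicity_times_same)
  next
    case False
    with less.prems have n: "n mod 12 \<in> {4, 8}" by auto presburger
    have "\<forall>k\<in>set [0..<24]. k mod 12 \<in> {4, 8} \<longrightarrow> fib k mod 9 \<in> {3, 6}" by code_simp
    from fib_mod_table[of "\<lambda>r. r \<in> {4, 8}", OF this] n have "fib n mod 9 \<in> {3, 6}" by simp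
    then have "multiplicity 3 (fib n) = 1"
      by (intro multiplicity_eq_mod[of _ _ _ "fib n mod 9"]) auto
    with False show ?thesis by (simp add: not_dvd_imp_multiplicity_0)
  qed
qed

section \<open>The product of five consecutive Fibonacci numbers\<close>

text \<open>This is the number b, written as an indexed product so that its valuations become sums
  over the window.\<close>

definition fib_window :: "nat \<Rightarrow> nat" where
  "fib_window n = (\<Prod>i\<in>{n..n + 4}. fib i)"

lemma multiplicity_fib_window:
  fixes p :: nat
  assumes "prime p" "n > 0"
  shows "multiplicity p (fib_window n) = (\<Sum>i\<in>{n..n + 4}. multiplicity p (fib i))"
proof -
  have "fib i \<noteq> 0" if "i \<in> {n..n + 4}" for i
    using that assms fib_neq_0_nat[of i] by auto
  then have "0 \<notin> fib ` {n..n + 4}" by (metis imageE)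
  with assms show ?thesis
    unfolding fib_window_def by (intro prime_elem_multiplicity_prod_distrib) auto
qed

text \<open>Such a prime divides at most one factor, because two factors have gcd
  \<open>fib d\<close> with \<open>d \<le> 4\<close>, that is 1, 2 or 3. The whole valuation
  therefore comes from a single \<open>fib i\<close>, which divides \<open>fib k\<close>.\<close>

lemma multiplicity_fib_window_le:
  fixes p :: nat
  assumes p: "prime p" "p \<noteq> 2" "p \<noteq> 3" and n: "n > 0"
    and k: "k > 0" "\<forall>i\<in>{n..n + 4}. i dvd k"
  shows "multiplicity p (fib_window n) \<le> multiplicity p (fib k)"
proof (cases "\<exists>i\<in>{n..n + 4}. p dvd fib i")
  case False
  then show ?thesis
    by (simp add: multiplicity_fib_window[OF p(1) n] not_dvd_imp_multiplicity_0)
next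
  case True
  then obtain i where i: "i \<in> {n..n + 4}" "p dvd fib i" by blast
  have other: "\<not> p dvd fib j" if j: "j \<in> {n..n + 4}" "j \<noteq> i" for j
  proof
    assume "p dvd fib j"
    define d where "d = gcd i j"
    have "p dvd fib d" using i \<open>p dvd fib j\<close> by (simp add: d_def fib_gcd)
    \<comment> \<open>With truncated subtraction this sum is the distance between \<open>i\<close>
      and \<open>j\<close>, which lies between 1 and 4.\<close>
    have "d dvd (i - j) + (j - i)"
      unfolding d_def by (cases "i \<le> j") (auto simp: dvd_diff_nat)
    with i j have "d \<le> 4" by (auto dest!: dvd_imp_le)
    moreover have "d > 0" using i n by (auto simp: d_def)
    ultimately have "d \<in> {1, 2, 3, 4}" by auto
    moreover have "\<forall>k\<in>{1, 2, 3, 4::nat}. fib k \<in> {1, 2, 3}" by code_simp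
    ultimately have "fib d \<in> {1, 2, 3}" by blast
    with \<open>p dvd fib d\<close> p show False
      using primes_dvd_imp_eq[of p 2] primes_dvd_imp_eq[of p 3] by auto
  qed
  have "multiplicity p (fib_window n) = (\<Sum>j\<in>{i}. multiplicity p (fib j))"
    unfolding multiplicity_fib_window[OF p(1) n]
    using i other by (intro sum.mono_neutral_right) (auto simp: not_dvd_imp_multiplicity_0)
  also have "\<dots> \<le> multiplicity p (fib k)"
    using i k fib_dvd[of i k] fib_neq_0_nat[of k] by (simp add: dvd_imp_multiplicity_le)
  finally show ?thesis .
qed

lemma fib_window_expand:
  "fib_window n = fib n * fib (n + 1) * fib (n + 2) * fib (n + 3) * fib (n + 4)"
  and multiplicity_fib_window_expand:
  "prime p \<Longrightarrow> n > 0 \<Longrightarrow> multiplicity p (fib_window n) =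
     multiplicity p (fib n) + multiplicity p (fib (n + 1)) + multiplicity p (fib (n + 2))
     + multiplicity p (fib (n + 3)) + multiplicity p (fib (n + 4))"
proof -
  have *: "{n..n + 4} = {n, n + 1, n + 2, n + 3, n + 4}" by auto
  show "fib_window n = fib n * fib (n + 1) * fib (n + 2) * fib (n + 3) * fib (n + 4)"
    unfolding fib_window_def * by (simp add: mult.assoc)
  show "prime p \<Longrightarrow> n > 0 \<Longrightarrow> multiplicity p (fib_window n) =
     multiplicity p (fib n) + multiplicity p (fib (n + 1)) + multiplicity p (fib (n + 2))
     + multiplicity p (fib (n + 3)) + multiplicity p (fib (n + 4))"
    using multiplicity_fib_window[of p n] unfolding * by simp
qed

section \<open>The lcm of the window of indices\<close>

lemma Lcm_window_dvd_iff:
  fixes n k :: nat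
  shows "Lcm {n, n + 1, n + 2, n + 3, n + 4} dvd k \<longleftrightarrow> (\<forall>i\<in>{n..n + 4}. i dvd k)"
proof -
  have "{n, n + 1, n + 2, n + 3, n + 4} = {n..n + 4}" by auto
  then show ?thesis by (simp add: Lcm_dvd_iff)
qed

text \<open>This makes both valuation formulas, for multiples of 6 and of 4, available at every
  multiple of the lcm.\<close>

lemma twelve_dvd_Lcm_window:
  "12 dvd Lcm {n, n + 1, n + 2, n + 3, n + 4 :: nat}"
proof -
  define a where "a = Lcm {n, n + 1, n + 2, n + 3, n + 4}"
  have a: "n dvd a" "n + 1 dvd a" "n + 2 dvd a" "n + 3 dvd a" "n + 4 dvd a"
    unfolding a_def by (auto intro: dvd_Lcm)
  have "3 dvd n \<or> 3 dvd n + 1 \<or> 3 dvd n + 2" by presburger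
  then have "3 dvd a" using a by (meson dvd_trans)
  moreover have "4 dvd n \<or> 4 dvd n + 1 \<or> 4 dvd n + 2 \<or> 4 dvd n + 3" by presburger
  then have "4 dvd a" using a by (meson dvd_trans)
  ultimately show ?thesis unfolding a_def by presburger
qed

lemma dvd_of_fib_window_dvd:
  assumes "fib_window n dvd fib k" "n > 0" "k > 0"
  shows "Lcm {n, n + 1, n + 2, n + 3, n + 4} dvd k"
  unfolding Lcm_window_dvd_iff
proof
  fix i assume i: "i \<in> {n..n + 4}"
  have dvd: "fib j dvd fib k" if "j \<in> {n..n + 4}" for j
    using that assms(1) unfolding fib_window_def by (meson dvd_prodI dvd_trans finite_atLeastAtMost)
  show "i dvd k"
  proof (cases "i = 2")
    \<comment> \<open>\<open>fib 2 = 1\<close> carries no information, but \<open>n\<close> is 1 or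
      2 here, so 4 is in the window and \<open>4 dvd k\<close> gives \<open>2 dvd k\<close>.\<close>
    case True
    with i assms(2) have "4 \<in> {n..n + 4}" by auto
    from dvd_of_fib_dvd[OF dvd[OF this]] assms(3) True show ?thesis by auto
  next
    case False
    with dvd_of_fib_dvd[OF dvd[OF i]] assms(3) show ?thesis by simp
  qed
qed

section \<open>The order in terms of the excesses at 2 and 3\<close>

text \<open>The upper bounds make \<open>2 ^ e * 3 ^ f * a\<close> admissible; the lower bounds
  force the extra factors into every admissible \<open>k\<close>. At excess 0,
  \<open>a dvd k\<close> already gives minimality at that prime, so the lower bounds are
  conditional.\<close>

lemma fib_order_fib_window:
  fixes n :: nat
  defines "a \<equiv> Lcm {n, n + 1, n + 2, n + 3, n + 4}"
  assumes n: "n > 0"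
    and le2: "multiplicity 2 (fib_window n) \<le> multiplicity 2 a + 2 + e"
    and ge2: "e > 0 \<Longrightarrow> multiplicity 2 a + 2 + e \<le> multiplicity 2 (fib_window n)"
    and le3: "multiplicity 3 (fib_window n) \<le> multiplicity 3 a + 1 + f"
    and ge3: "f > 0 \<Longrightarrow> multiplicity 3 a + 1 + f \<le> multiplicity 3 (fib_window n)"
  shows "fib_order (fib_window n) = 2 ^ e * 3 ^ f * a"
proof -
  define m where "m = 2 ^ e * 3 ^ f * a"
  have "a \<noteq> 0" using n by (simp add: a_def)
  then have a: "a > 0" "12 dvd a"
    using twelve_dvd_Lcm_window[of n] unfolding a_def[symmetric] by simp_all
  have mult_m: "multiplicity p m = multiplicity p a + (if p = 2 then e else if p = 3 then f else 0)"
    if "prime p" for p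
    unfolding m_def using that a
    by (auto simp: prime_elem_multiplicity_mult_distrib prime_elem_multiplicity_power_distrib
          prime_multiplicity_other)
  have mult_fib: "multiplicity 2 (fib k) = multiplicity 2 k + 2"
    "multiplicity 3 (fib k) = multiplicity 3 k + 1" if "a dvd k" "k > 0" for k
  proof -
    have "12 dvd k" using a(2) that(1) by (rule dvd_trans)
    then have "6 dvd k" "4 dvd k" by presburger+
    with that show "multiplicity 2 (fib k) = multiplicity 2 k + 2"
      "multiplicity 3 (fib k) = multiplicity 3 k + 1"
      by (simp_all add: multiplicity_2_fib multiplicity_3_fib)
  qed
  have m: "m > 0" "a dvd m" using a by (auto simp: m_def)
  have "fib_window n dvd fib m"
  proof (rule multiplicity_le_imp_dvd)
    show "fib_window n \<noteq> 0"
      using n fib_neq_0_nat by (fastforce simp: fib_window_def)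
    fix p :: nat assume p: "prime p"
    consider "p = 2" | "p = 3" | "p \<noteq> 2" "p \<noteq> 3" by blast
    then show "multiplicity p (fib_window n) \<le> multiplicity p (fib m)"
    proof cases
      case 3
      have "\<forall>i\<in>{n..n + 4}. i dvd m"
        using m(2) unfolding a_def Lcm_window_dvd_iff .
      with multiplicity_fib_window_le[OF p 3 n m(1)] show ?thesis by blast
    qed (use le2 le3 mult_m[OF p] mult_fib[OF m(2,1)] in auto)
  qed
  moreover have "m dvd k" if k: "k > 0" "fib_window n dvd fib k" for k
  proof (rule multiplicity_le_imp_dvd)
    show "m \<noteq> 0" using m by simp
    have "a dvd k" using dvd_of_fib_window_dvd[OF k(2) n k(1)] by (simp add: a_def)
    fix p :: nat assume p: "prime p"
    have "multiplicity p (fib_window n) \<le> multiplicity p (fib k)"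
      "multiplicity p a \<le> multiplicity p k"
      using k \<open>a dvd k\<close> fib_neq_0_nat[of k] by (simp_all add: dvd_imp_multiplicity_le)
    \<comment> \<open>For \<open>p = 2\<close> and \<open>e > 0\<close>, the chain is
      \<open>multiplicity 2 a + 2 + e \<le> multiplicity 2 (fib_window n) \<le> multiplicity 2 k +
      2\<close>; the prime 3 is analogous.\<close>
    then show "multiplicity p m \<le> multiplicity p k"
      using ge2 ge3 mult_fib[OF \<open>a dvd k\<close> k(1)] unfolding mult_m[OF p]
      by (cases "e > 0"; cases "f > 0") auto
  qed
  then have "m \<le> k" if "k > 0" "fib_window n dvd fib k" for k
    using that by (simp add: dvd_imp_le)
  ultimately have "fib_order (fib_window n) = m"
    unfolding fib_order_def using m(1) by (intro Least_equality) auto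
  then show ?thesis by (simp add: m_def)
qed

section \<open>The excesses by residue class\<close>

lemma multiplicity_lcm:
  fixes x y :: nat
  assumes "prime p" "x > 0" "y > 0"
  shows "multiplicity p (lcm x y) = max (multiplicity p x) (multiplicity p y)"
  using assms
  by (simp flip: count_prime_factorization_prime add: prime_factorization_lcm)

lemma multiplicity_Lcm_window:
  fixes p n :: nat
  assumes "prime p" "n > 0"
  shows "multiplicity p (Lcm {n, n + 1, n + 2, n + 3, n + 4}) =
    max (multiplicity p n) (max (multiplicity p (n + 1)) (max (multiplicity p (n + 2))
      (max (multiplicity p (n + 3)) (multiplicity p (n + 4)))))"
proof -
  have "Lcm {n, n + 1, n + 2, n + 3, n + 4} =
      lcm n (lcm (n + 1) (lcm (n + 2) (lcm (n + 3) (n + 4))))"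
    by simp
  then show ?thesis
    using assms by (simp only:) (simp add: multiplicity_lcm lcm_pos_nat)
qed

text \<open>The residue leaves the valuation of a multiple of 8 open. The bound
  \<open>\<ge> 3\<close> suffices: a window has at most one multiple of 8, which then attains the
  maximum in the lcm.\<close>

lemma multiplicity_2_mod_24:
  fixes j :: nat
  assumes "j mod 24 = r" "j > 0"
  shows "if odd r then multiplicity 2 j = 0 else if r mod 4 = 2 then multiplicity 2 j = 1
    else if r mod 8 = 4 then multiplicity 2 j = 2 else multiplicity 2 j \<ge> 3"
proof -
  have r: "r mod 4 = j mod 4" "r mod 8 = j mod 8" "odd r \<longleftrightarrow> odd j"
    using mod_mod_cancel[of 4 24 j] mod_mod_cancel[of 8 24 j] mod_mod_cancel[of 2 24 j] assms(1)
    by (simp_all add: odd_iff_mod_2_eq_one)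
  have "multiplicity 2 j \<ge> 3" if "even j" "j mod 4 \<noteq> 2" "j mod 8 \<noteq> 4"
  proof (rule multiplicity_geI)
    have "j mod 8 = 0" using that by presburger
    then show "2 ^ 3 dvd j" by auto
  qed (use assms in auto)
  then show ?thesis
    using multiplicity_eq_mod[of j 2 1 2] multiplicity_eq_mod[of j 2 2 4] unfolding r
    by (auto simp: not_dvd_imp_multiplicity_0)
qed

lemma multiplicity_2_fib_mod_24:
  assumes "j mod 24 = r" "j > 0"
  shows "multiplicity 2 (fib j) =
    (if r mod 3 \<noteq> 0 then 0 else if odd r then 1 else multiplicity 2 j + 2)"
proof -
  have r: "r mod 3 = j mod 3" "odd r \<longleftrightarrow> odd j"
    using mod_mod_cancel[of 3 24 j] mod_mod_cancel[of 2 24 j] assms(1)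
    by (simp_all add: odd_iff_mod_2_eq_one)
  consider "j mod 3 \<noteq> 0" | "j mod 3 = 0" "odd j" | "j mod 3 = 0" "even j" by blast
  then show ?thesis
  proof cases
    case 1
    then have "odd (fib j)" unfolding odd_fib_iff by auto
    then have "multiplicity 2 (fib j) = 0" by (rule not_dvd_imp_multiplicity_0)
    with 1 show ?thesis by (simp add: r)
  next
    case 2
    then have "j mod 6 = 3" by presburger
    with 2 show ?thesis by (simp add: r multiplicity_2_fib_odd)
  next
    case 3
    then have "6 dvd j" by presburger
    with 3 show ?thesis using assms(2) by (simp add: r multiplicity_2_fib)
  qed
qed

text \<open>Likewise a window has at most one multiple of 9, which dominates the lcm at 3. The
  factor 4 of 36 decides whether 3 divides \<open>fib j\<close>.\<close>

lemma multiplicity_3_mod_36: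
  fixes j :: nat
  assumes "j mod 36 = r" "j > 0"
  shows "if r mod 3 \<noteq> 0 then multiplicity 3 j = 0
    else if r mod 9 \<noteq> 0 then multiplicity 3 j = 1 else multiplicity 3 j \<ge> 2"
proof -
  have r: "r mod 3 = j mod 3" "r mod 9 = j mod 9"
    using mod_mod_cancel[of 3 36 j] mod_mod_cancel[of 9 36 j] assms(1) by simp_all
  have "multiplicity 3 j = 1" if "j mod 3 = 0" "j mod 9 \<noteq> 0"
  proof (rule multiplicity_eqI)
    show "3 ^ 1 dvd j" using that by auto
    show "\<not> 3 ^ Suc 1 dvd j" using that by (simp add: dvd_eq_mod_eq_0)
  qed
  moreover have "multiplicity 3 j \<ge> 2" if "j mod 9 = 0"
    by (rule multiplicity_geI) (use that assms in auto)
  ultimately show ?thesis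
    unfolding r by (auto simp: not_dvd_imp_multiplicity_0 dvd_eq_mod_eq_0)
qed

lemma multiplicity_3_fib_mod_36:
  assumes "j mod 36 = r" "j > 0"
  shows "multiplicity 3 (fib j) = (if r mod 4 \<noteq> 0 then 0 else multiplicity 3 j + 1)"
proof -
  have "r mod 4 = j mod 4" using mod_mod_cancel[of 4 36 j] assms(1) by simp
  then show ?thesis
    using assms(2) three_dvd_fib_iff[of j] multiplicity_3_fib[of j]
    by (simp add: not_dvd_imp_multiplicity_0 dvd_eq_mod_eq_0)
qed

text \<open>The listed classes are those where the window has two multiples of 3 and the even one
  has the largest valuation at 2: it contributes that maximum plus 2, and the odd one adds
  1.\<close>

lemma multiplicity_2_fib_window:
  fixes n :: nat
  assumes "n > 0"
  defines "a \<equiv> Lcm {n, n + 1, n + 2, n + 3, n + 4}"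
  shows "if n mod 24 \<in> {0, 9, 11, 20, 21, 23}
    then multiplicity 2 (fib_window n) = multiplicity 2 a + 3
    else multiplicity 2 (fib_window n) \<le> multiplicity 2 a + 2"
proof -
  define v w where "v i = multiplicity 2 (n + i)" and "w i = multiplicity 2 (fib (n + i))" for i
  define r where "r = n mod 24"
  have shift: "(n + i) mod 24 = (r + i) mod 24" for i
    by (simp add: r_def mod_add_left_eq)
  note vi = multiplicity_2_mod_24[OF shift, folded v_def]
  note wi = multiplicity_2_fib_mod_24[OF shift, folded v_def w_def]
  have A: "multiplicity 2 a = max (v 0) (max (v 1) (max (v 2) (max (v 3) (v 4))))"
    unfolding a_def using multiplicity_Lcm_window[of 2 n] assms(1) by (simp add: v_def)
  have V: "multiplicity 2 (fib_window n) = w 0 + w 1 + w 2 + w 3 + w 4"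
    using multiplicity_fib_window_expand[of 2 n] assms(1) by (simp add: w_def)
  have "r \<in> {..<24}" by (simp add: r_def)
  then show ?thesis
    unfolding A V r_def[symmetric] using vi[of 0] vi[of 1] vi[of 2] vi[of 3] vi[of 4]
      wi[of 0] wi[of 1] wi[of 2] wi[of 3] wi[of 4] assms(1)
    \<comment> \<open>Splitting into the 24 values of \<open>r\<close> makes every residue condition
      concrete and leaves linear arithmetic in the \<open>v i\<close>.\<close>
    by (simp only: lessThan_nat_numeral lessThan_0 pred_numeral_simps BitM.simps insert_iff empty_iff)
      (elim disjE; simp)
qed

text \<open>The listed classes are those where \<open>n\<close> and \<open>n + 4\<close> are both
  multiples of 4 and one of them has the largest valuation at 3. At most one of the two is divisible
  by 3, so together they contribute that maximum plus 2.\<close>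

lemma multiplicity_3_fib_window:
  fixes n :: nat
  assumes "n > 0"
  defines "a \<equiv> Lcm {n, n + 1, n + 2, n + 3, n + 4}"
  shows "if n mod 36 \<in> {0, 12, 20, 32}
    then multiplicity 3 (fib_window n) = multiplicity 3 a + 2
    else multiplicity 3 (fib_window n) \<le> multiplicity 3 a + 1"
proof -
  define v w where "v i = multiplicity 3 (n + i)" and "w i = multiplicity 3 (fib (n + i))" for i
  define r where "r = n mod 36"
  have shift: "(n + i) mod 36 = (r + i) mod 36" for i
    by (simp add: r_def mod_add_left_eq)
  note vi = multiplicity_3_mod_36[OF shift, folded v_def]
  note wi = multiplicity_3_fib_mod_36[OF shift, folded v_def w_def]
  have A: "multiplicity 3 a = max (v 0) (max (v 1) (max (v 2) (max (v 3) (v 4))))"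
    unfolding a_def using multiplicity_Lcm_window[of 3 n] assms(1) by (simp add: v_def)
  have V: "multiplicity 3 (fib_window n) = w 0 + w 1 + w 2 + w 3 + w 4"
    using multiplicity_fib_window_expand[of 3 n] assms(1) by (simp add: w_def)
  have "r \<in> {..<36}" by (simp add: r_def)
  then show ?thesis
    unfolding A V r_def[symmetric] using vi[of 0] vi[of 1] vi[of 2] vi[of 3] vi[of 4]
      wi[of 0] wi[of 1] wi[of 2] wi[of 3] wi[of 4] assms(1)
    by (simp only: lessThan_nat_numeral lessThan_0 pred_numeral_simps BitM.simps insert_iff empty_iff)
      (elim disjE; simp)
qed

section \<open>Combination of both excesses modulo 72\<close>

theorem theorem3p2:
  fixes n a b :: nat
  assumes "n \<ge> 1"
    and "a = Lcm {n, n + 1, n + 2, n + 3, n + 4}"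
    and "b = fib n * fib (n + 1) * fib (n + 2) * fib (n + 3) * fib (n + 4)"
  shows "(n mod 12 \<in> {1, 2, 3, 4, 5, 6, 7, 10} \<or> n mod 72 \<in> {8, 60} \<longrightarrow> fib_order b = a) \<and>
         (n mod 12 \<in> {9, 11} \<or> n mod 72 \<in> {24, 44} \<longrightarrow> fib_order b = 2 * a) \<and>
         (n mod 72 \<in> {12, 32, 36, 56} \<longrightarrow> fib_order b = 3 * a) \<and>
         (n mod 72 \<in> {0, 20, 48, 68} \<longrightarrow> fib_order b = 6 * a)"
proof -
  define r where "r = n mod 72"
  define e f :: nat where "e = (if n mod 24 \<in> {0, 9, 11, 20, 21, 23} then 1 else 0)"
    and "f = (if n mod 36 \<in> {0, 12, 20, 32} then 1 else 0)"
  have n: "n > 0" using assms(1) by simp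
  have "fib_order (fib_window n) = 2 ^ e * 3 ^ f * a"
    unfolding assms(2)
    using multiplicity_2_fib_window[OF n] multiplicity_3_fib_window[OF n]
    by (intro fib_order_fib_window n) (simp_all add: e_def f_def split: if_splits)
  then have b: "fib_order b = 2 ^ e * 3 ^ f * a"
    by (simp add: assms(3) fib_window_expand)
  have mods: "n mod 12 = r mod 12" "n mod 24 = r mod 24" "n mod 36 = r mod 36"
    by (simp_all add: r_def mod_mod_cancel)
  \<comment> \<open>As 72 is the lcm of 24 and 36, \<open>r\<close> determines \<open>e\<close> and
    \<open>f\<close>, and matching them with the stated cases is a finite check.\<close>
  have "\<forall>r\<in>set [0..<72].
      (r mod 12 \<in> {1, 2, 3, 4, 5, 6, 7, 10} \<or> r \<in> {8, 60} \<longrightarrow>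
        r mod 24 \<notin> {0, 9, 11, 20, 21, 23} \<and> r mod 36 \<notin> {0, 12, 20, 32}) \<and>
      (r mod 12 \<in> {9, 11} \<or> r \<in> {24, 44} \<longrightarrow>
        r mod 24 \<in> {0, 9, 11, 20, 21, 23} \<and> r mod 36 \<notin> {0, 12, 20, 32}) \<and>
      (r \<in> {12, 32, 36, 56} \<longrightarrow>
        r mod 24 \<notin> {0, 9, 11, 20, 21, 23} \<and> r mod 36 \<in> {0, 12, 20, 32}) \<and>
      (r \<in> {0, 20, 48, 68} \<longrightarrow>
        r mod 24 \<in> {0, 9, 11, 20, 21, 23} \<and> r mod 36 \<in> {0, 12, 20, 32})"
    by code_simp
  moreover have "r \<in> set [0..<72]" by (simp add: r_def)
  ultimately have cases:
    "n mod 12 \<in> {1, 2, 3, 4, 5, 6, 7, 10} \<or> n mod 72 \<in> {8, 60} \<longrightarrow> e = 0 \<and> f = 0"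
    "n mod 12 \<in> {9, 11} \<or> n mod 72 \<in> {24, 44} \<longrightarrow> e = 1 \<and> f = 0"
    "n mod 72 \<in> {12, 32, 36, 56} \<longrightarrow> e = 0 \<and> f = 1"
    "n mod 72 \<in> {0, 20, 48, 68} \<longrightarrow> e = 1 \<and> f = 1"
    unfolding e_def f_def mods r_def[symmetric] by (metis (no_types, lifting))+
  show ?thesis
    unfolding b by (intro conjI impI; drule cases[THEN mp]; simp)
qed

end
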